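(* Let $q$ be a prime power and $n$ an odd positive integer with $\gcd(n,q)=1$. The multiplier $\mu_{-q}$ gives a splitting of $n$ over $\mathbb{F}_{q^2}$ if and only if for every prime $r$ dividing $n$, either $\mathrm{ord}_r(q)$ is odd or $\mathrm{ord}_r(q^2)$ is even.
   Context: $\mathrm{ord}_r(q)$ is the smallest positive integer $t$ with $q^t\equiv1\pmod r$. The $q^2$-cyclotomic coset of $s$ modulo $n$ is $\{s(q^2)^j\bmod n:j\ge0\}$. For $\gcd(b,n)=1$, $\mu_b$ gives a splitting of $n$ over $\mathbb{F}_{q^2}$ if there are sets $S_1,S_2$, each a union of $q^2$-cyclotomic cosets modulo $n$, with $S_1\cup S_2=\{1,\dots,n-1\}$, $S_1\cap S_2=\emptyset$, $bS_1\equiv S_2$ and $bS_2\equiv S_1\pmod n$. *)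

theory Defs
  imports "HOL-Number_Theory.Number_Theory"
begin

(* The Q-cyclotomic coset of s modulo n, with residues represented in {0..<n}.
   Integers are used so that negative multipliers such as -q make sense. *)
definition cyclotomic_coset :: "int \<Rightarrow> int \<Rightarrow> int \<Rightarrow> int set" where
  "cyclotomic_coset Q n s = {(s * Q ^ j) mod n | j :: nat. True}"

definition union_of_cyclotomic_cosets :: "int \<Rightarrow> int \<Rightarrow> int set \<Rightarrow> bool" where
  "union_of_cyclotomic_cosets Q n S \<longleftrightarrow> (\<exists>T. S = (\<Union>s\<in>T. cyclotomic_coset Q n s))"

(* The multiplier s \<mapsto> b * s mod n gives a splitting of n over the field with Q elements.
   As S1 and S2 consist of reduced residues, the congruence b S1 = S2 (mod n) of sets
   of residues is an equality of sets after reducing b S1. *)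
definition gives_splitting :: "int \<Rightarrow> int \<Rightarrow> int \<Rightarrow> bool" where
  "gives_splitting Q n b \<longleftrightarrow>
     coprime b n \<and>
     (\<exists>S1 S2.
        union_of_cyclotomic_cosets Q n S1 \<and>
        union_of_cyclotomic_cosets Q n S2 \<and>
        S1 \<union> S2 = {1..n - 1} \<and> S1 \<inter> S2 = {} \<and>
        (\<lambda>s. (b * s) mod n) ` S1 = S2 \<and>
        (\<lambda>s. (b * s) mod n) ` S2 = S1)"

end

theory Submission
  imports Defs
begin

text \<open>Put \<open>b = - q\<close>, so \<open>b\<^sup>2 = q\<^sup>2\<close> and the cosets are
  the orbits of multiplication by \<open>b\<^sup>2\<close>. In a splitting, \<open>b\<close>
  exchanges the two sets, so no odd power of \<open>b\<close> can fix a nonzero residue. Conversely,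
  if no odd power does, the cosets of \<open>s\<close> and \<open>b * s\<close> are always distinct
  and one of each pair can be put in either set (\<open>gives_splittingI\<close>). An odd power
  \<open>b ^ k\<close> fixes a nonzero residue exactly when it is 1 modulo some prime divisor
  \<open>r\<close> of \<open>n\<close> (\<open>gives_splitting_iff_no_odd_power_cong_1\<close>). For
  odd \<open>k\<close> this means \<open>q ^ k = - 1\<close> modulo \<open>r\<close>, which
  \<open>odd_power_cong_minus_1_iff_ord\<close> translates into the parities of the orders of
  \<open>q\<close> and \<open>q\<^sup>2\<close>.\<close>

lemma int_power_cong_1_exists:
  fixes a n :: int
  assumes "n > 0" "coprime a n"
  obtains p :: nat where "p > 0" "[a ^ p = 1] (mod n)"
proof
  let ?a = "nat (a mod n)" and ?n = "nat n"
  have "coprime ?a ?n"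
    using assms by (simp flip: coprime_int_iff)
  then have "[?a ^ totient ?n = 1] (mod ?n)"
    by (rule euler_theorem)
  then have "[(a mod n) ^ totient ?n = 1] (mod n)"
    using assms by (simp flip: cong_int_iff)
  then show "[a ^ totient ?n = 1] (mod n)"
    by (simp add: cong_def power_mod)
  show "totient ?n > 0"
    using assms by simp
qed

text \<open>\<open>Q\<close> is a unit of finite order modulo \<open>n\<close>, so cosets are orbits
  of a group, and orbits that meet coincide.\<close>

lemma cyclotomic_coset_eqI:
  assumes "n > 0" "coprime Q n" "t \<in> cyclotomic_coset Q n s"
  shows "cyclotomic_coset Q n t = cyclotomic_coset Q n s"
proof -
  obtain i where t: "t = (s * Q ^ i) mod n"
    using assms(3) by (auto simp: cyclotomic_coset_def)
  obtain p where p: "p > 0" "[Q ^ p = 1] (mod n)"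
    using int_power_cong_1_exists assms by metis
  have shift: "(t * Q ^ j) mod n = (s * Q ^ (i + j)) mod n" for j
    by (simp add: t mod_mult_left_eq power_add mult.assoc)
  \<comment> \<open>As \<open>Q ^ p = 1\<close>, multiplying by \<open>Q ^ (i * (p - 1))\<close>
    undoes \<open>Q ^ i\<close> without a negative exponent.\<close>
  have "(s * Q ^ j) mod n = (t * Q ^ (j + i * (p - 1))) mod n" for j
  proof -
    have "[Q ^ (i * p) = 1] (mod n)"
      using cong_pow[OF p(2), of i] by (metis power_mult mult.commute power_one)
    then have "[(s * Q ^ j) * Q ^ (i * p) = (s * Q ^ j) * 1] (mod n)"
      by (rule cong_scalar_left)
    moreover have "i * p = i + i * (p - 1)"
      using p(1) by (cases p) auto
    ultimately show ?thesis
      unfolding shift by (simp add: cong_def power_add mult_ac)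
  qed
  with shift show ?thesis
    unfolding cyclotomic_coset_def by blast
qed

lemma self_in_cyclotomic_coset:
  assumes "s \<in> {1..n - 1}"
  shows "s \<in> cyclotomic_coset Q n s"
  unfolding cyclotomic_coset_def using assms by (auto intro!: exI[of _ 0])

lemma finite_cyclotomic_coset:
  assumes "n > 0"
  shows "finite (cyclotomic_coset Q n s)"
  by (rule finite_subset[of _ "{0..<n}"]) (use assms in \<open>auto simp: cyclotomic_coset_def\<close>)

lemma union_of_cyclotomic_cosetsI:
  assumes "S \<subseteq> {1..n - 1}"
    and "\<And>s. s \<in> S \<Longrightarrow> cyclotomic_coset Q n s \<subseteq> S"
  shows "union_of_cyclotomic_cosets Q n S"
  unfolding union_of_cyclotomic_cosets_def
proof (intro exI[of _ S] equalityI subsetI)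
  show "s \<in> (\<Union>s\<in>S. cyclotomic_coset Q n s)" if "s \<in> S" for s
    using assms(1) self_in_cyclotomic_coset that by blast
qed (use assms(2) in blast)

lemma mult_mod_in_nonzero_residues:
  fixes b n s :: int
  assumes "n > 0" "coprime b n" "s \<in> {1..n - 1}"
  shows "(b * s) mod n \<in> {1..n - 1}"
proof -
  have "\<not> n dvd s"
    using assms zdvd_imp_le[of n s] by auto
  then have "\<not> n dvd b * s"
    using assms(2) by (simp add: coprime_commute coprime_dvd_mult_right_iff)
  then have "(b * s) mod n \<noteq> 0"
    by (simp add: dvd_eq_mod_eq_0)
  then show ?thesis
    using assms(1) pos_mod_bound[of n "b * s"] pos_mod_sign[of n "b * s"]
    by (smt (verit) atLeastAtMost_iff)
qed

lemma inj_on_mult_mod: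
  fixes b n :: int
  assumes "coprime b n" "S \<subseteq> {1..n - 1}"
  shows "inj_on (\<lambda>s. (b * s) mod n) S"
proof (rule inj_onI)
  fix s t assume "s \<in> S" "t \<in> S" "(b * s) mod n = (b * t) mod n"
  then have "[s = t] (mod n)"
    using assms(1) by (simp add: cong_mult_lcancel flip: cong_def)
  then show "s = t"
    using \<open>s \<in> S\<close> \<open>t \<in> S\<close> assms(2) by (intro cong_less_imp_eq_int[of s n t]) auto
qed

text \<open>Each factor \<open>b\<close> changes sides, so only the parity of \<open>k\<close>
  matters.\<close>

lemma odd_power_swaps:
  fixes b n s :: int
  assumes "(\<lambda>s. (b * s) mod n) ` A \<subseteq> B" "(\<lambda>s. (b * s) mod n) ` B \<subseteq> A"
    and "A \<union> B \<subseteq> {1..n - 1}" "s \<in> A"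
  shows "(s * b ^ k) mod n \<in> (if odd k then B else A)"
proof (induction k)
  case 0
  then show ?case using assms by auto
next
  case (Suc k)
  have "(s * b ^ Suc k) mod n = (b * ((s * b ^ k) mod n)) mod n"
    by (simp add: mod_mult_right_eq mult_ac)
  also have "\<dots> \<in> (if odd (Suc k) then B else A)"
    using Suc.IH assms(1,2) by (cases "odd k") (simp_all add: image_subset_iff)
  finally show ?case .
qed

text \<open>When no odd power of \<open>b\<close> fixes a residue, the cosets of \<open>s\<close> and \<open>b s\<close> are disjoint; comparing
  their minima selects one coset of each pair without choosing orbit representatives.\<close>

lemma gives_splittingI:
  fixes b n :: int
  assumes n: "n > 0" and b: "coprime b n"
    and free: "\<And>s k. s \<in> {1..n - 1} \<Longrightarrow> odd k \<Longrightarrow> \<not> [s * b ^ k = s] (mod n)"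
  shows "gives_splitting (b\<^sup>2) n b"
proof -
  let ?C = "cyclotomic_coset (b\<^sup>2) n"
  let ?m = "\<lambda>s. (b * s) mod n"
  define f where "f s = Min (?C s)" for s
  have Q: "coprime (b\<^sup>2) n"
    using b by simp
  have f_in: "f s \<in> ?C s" for s
    unfolding f_def
    by (rule Min_in) (use finite_cyclotomic_coset[OF n] in \<open>auto simp: cyclotomic_coset_def\<close>)
  have f_eq: "f t = f s" if "t \<in> ?C s" for s t
    unfolding f_def by (simp only: cyclotomic_coset_eqI[OF n Q that])
  have m_coset: "?m t \<in> ?C (?m s)" if t: "t \<in> ?C s" for s t
  proof -
    obtain j where "t = (s * (b\<^sup>2) ^ j) mod n"
      using t by (auto simp: cyclotomic_coset_def)
    then have "?m t = (?m s * (b\<^sup>2) ^ j) mod n"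
      by (simp add: mod_mult_left_eq mod_mult_right_eq mult_ac)
    then show ?thesis
      by (auto simp: cyclotomic_coset_def)
  qed
  have mm: "?m (?m s) \<in> ?C s" for s
    unfolding cyclotomic_coset_def
    by (auto intro!: exI[of _ 1] simp: mod_mult_right_eq power2_eq_square mult_ac)
  have f_neq: "f s \<noteq> f (?m s)" if s: "s \<in> {1..n - 1}" for s
  proof
    assume "f s = f (?m s)"
    \<comment> \<open>A common minimum lies in both cosets, which therefore coincide.\<close>
    then have "?C (?m s) = ?C s"
      using cyclotomic_coset_eqI[OF n Q f_in] by metis
    then have "s \<in> ?C (?m s)"
      using self_in_cyclotomic_coset[OF s] by simp
    then obtain j where "s = (?m s * (b\<^sup>2) ^ j) mod n"
      by (auto simp: cyclotomic_coset_def)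
    \<comment> \<open>One factor \<open>b\<close> from \<open>?m\<close> and an even number from the
      coset make an odd power fixing \<open>s\<close>.\<close>
    then have "s = (s * b ^ Suc (2 * j)) mod n"
      by (simp add: mod_mult_left_eq mult_ac flip: power_mult)
    then have "[s * b ^ Suc (2 * j) = s] (mod n)"
      by (metis cong_mod_left cong_refl)
    then show False
      using free[OF s, of "Suc (2 * j)"] by simp
  qed
  define S1 where "S1 = {s \<in> {1..n - 1}. f s < f (?m s)}"
  define S2 where "S2 = {s \<in> {1..n - 1}. f (?m s) < f s}"
  have coset_sub: "?C s \<subseteq> {1..n - 1}" if "s \<in> {1..n - 1}" for s
  proof
    fix t assume "t \<in> ?C s"
    then obtain j where "t = ((b\<^sup>2) ^ j * s) mod n"
      by (auto simp: cyclotomic_coset_def mult.commute)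
    then show "t \<in> {1..n - 1}"
      using mult_mod_in_nonzero_residues[OF n _ that, of "(b\<^sup>2) ^ j"] Q by simp
  qed
  have f_inv: "f t = f s \<and> f (?m t) = f (?m s)" if "t \<in> ?C s" for s t
    using f_eq m_coset that by blast
  have union1: "union_of_cyclotomic_cosets (b\<^sup>2) n S1"
  proof (rule union_of_cyclotomic_cosetsI)
    show "?C s \<subseteq> S1" if "s \<in> S1" for s
      using coset_sub[of s] f_inv[of _ s] that unfolding S1_def by fastforce
  qed (auto simp: S1_def)
  have union2: "union_of_cyclotomic_cosets (b\<^sup>2) n S2"
  proof (rule union_of_cyclotomic_cosetsI)
    show "?C s \<subseteq> S2" if "s \<in> S2" for s
      using coset_sub[of s] f_inv[of _ s] that unfolding S2_def by fastforce
  qed (auto simp: S2_def)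
  have cover: "S1 \<union> S2 = {1..n - 1}"
    using f_neq unfolding S1_def S2_def by fastforce
  have disjoint: "S1 \<inter> S2 = {}"
    by (auto simp: S1_def S2_def)
  have swap: "?m ` S1 = S2 \<and> ?m ` S2 = S1"
  proof -
    \<comment> \<open>By \<open>mm\<close>, applying \<open>?m\<close> twice returns to the coset of
      \<open>s\<close>, so \<open>?m\<close> exchanges the two minima being compared.\<close>
    have sub: "?m ` S1 \<subseteq> S2" "?m ` S2 \<subseteq> S1"
      using mult_mod_in_nonzero_residues[OF n b] f_eq[OF mm] by (auto simp: S1_def S2_def)
    have fin: "finite S1" "finite S2"
      by (rule finite_subset[of _ "{1..n - 1}"]; auto simp: S1_def S2_def)+
    have card: "card (?m ` S1) = card S1" "card (?m ` S2) = card S2"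
      by (intro card_image inj_on_mult_mod b; auto simp: S1_def S2_def)+
    \<comment> \<open>Injectivity and the two inclusions bound each cardinality by the other;
      finiteness then turns the inclusions into equalities.\<close>
    have "card S1 = card S2"
      using card card_mono[OF fin(2) sub(1)] card_mono[OF fin(1) sub(2)] by linarith
    then show ?thesis
      using card_subset_eq[OF fin(2) sub(1)] card_subset_eq[OF fin(1) sub(2)] card by simp
  qed
  show ?thesis
    unfolding gives_splitting_def
    by (rule conjI[OF b], rule exI[of _ S1], rule exI[of _ S2])
      (intro conjI union1 union2 cover disjoint swap[THEN conjunct1] swap[THEN conjunct2])
qed

text \<open>The link is fixed residues: \<open>b ^ k\<close> fixes a nonzero residue modulo
  \<open>n\<close> exactly when \<open>b ^ k - 1\<close> shares a prime factor with
  \<open>n\<close>.\<close>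

lemma gives_splitting_iff_no_odd_power_cong_1:
  fixes b n :: int
  assumes n: "n > 0" and b: "coprime b n"
  shows "gives_splitting (b\<^sup>2) n b \<longleftrightarrow>
    (\<forall>r. prime r \<and> r dvd n \<longrightarrow> (\<forall>k. odd k \<longrightarrow> \<not> [b ^ k = 1] (mod r)))"
proof (intro iffI allI impI notI)
  fix r :: int and k :: nat
  assume split: "gives_splitting (b\<^sup>2) n b" and r: "prime r \<and> r dvd n"
    and k: "odd k" "[b ^ k = 1] (mod r)"
  \<comment> \<open>The residue \<open>n / r\<close> is nonzero and is annihilated by every multiple
    of \<open>r\<close>, in particular by \<open>b ^ k - 1\<close>.\<close>
  obtain s where s: "n = r * s"
    using r by auto
  have "r > 1"
    using r prime_gt_1_int by blast
  then have "s > 0" "s < n"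
    using n s by (auto simp: zero_less_mult_iff)
  have "r * s dvd (b ^ k - 1) * s"
    using k(2) by (simp add: cong_iff_dvd_diff)
  then have "[s * b ^ k = s] (mod n)"
    by (simp add: s cong_iff_dvd_diff algebra_simps)
  then have fix_s: "(s * b ^ k) mod n = s"
    using \<open>s > 0\<close> \<open>s < n\<close> by (simp add: cong_def)
  obtain S1 S2 where S: "S1 \<union> S2 = {1..n - 1}" "S1 \<inter> S2 = {}"
      "(\<lambda>s. (b * s) mod n) ` S1 = S2" "(\<lambda>s. (b * s) mod n) ` S2 = S1"
    using split unfolding gives_splitting_def by (elim conjE exE) (rule that)
  have "s \<in> S1 \<or> s \<in> S2"
    using S(1) \<open>s > 0\<close> \<open>s < n\<close> by auto
  moreover have "s \<in> S1 \<Longrightarrow> s \<in> S2"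
    using odd_power_swaps[of b n S1 S2 s k] S(1,3,4) k(1) unfolding fix_s by simp
  moreover have "s \<in> S2 \<Longrightarrow> s \<in> S1"
    using odd_power_swaps[of b n S2 S1 s k] S(1,3,4) k(1) unfolding fix_s by (simp add: Un_commute)
  ultimately show False
    using S(2) by blast
next
  assume *: "\<forall>r. prime r \<and> r dvd n \<longrightarrow> (\<forall>k. odd k \<longrightarrow> \<not> [b ^ k = 1] (mod r))"
  show "gives_splitting (b\<^sup>2) n b"
  proof (rule gives_splittingI[OF n b])
    fix s :: int and k :: nat
    assume s: "s \<in> {1..n - 1}" and k: "odd k"
    show "\<not> [s * b ^ k = s] (mod n)"
    proof
      assume "[s * b ^ k = s] (mod n)"
      then have dvd: "n dvd s * (b ^ k - 1)"
        by (simp add: cong_iff_dvd_diff algebra_simps)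
      \<comment> \<open>A common prime factor \<open>r\<close> would give \<open>b ^ k = 1\<close>
        modulo \<open>r\<close>, against the hypothesis.\<close>
      have "coprime n (b ^ k - 1)"
      proof (rule ccontr)
        assume "\<not> coprime n (b ^ k - 1)"
        then have "\<not> is_unit (gcd n (b ^ k - 1))"
          by (simp add: coprime_iff_gcd_eq_1)
        moreover have "gcd n (b ^ k - 1) \<noteq> 0"
          using n by simp
        ultimately obtain r where "prime r" "r dvd gcd n (b ^ k - 1)"
          using prime_divisor_exists by blast
        then show False
          using * k by (auto simp: cong_iff_dvd_diff)
      qed
      then have "n dvd s"
        using dvd by (simp add: coprime_dvd_mult_left_iff)
      then show False
        using s zdvd_imp_le[of n s] by auto
    qed
  qed
qed

text \<open>An odd \<open>k\<close> with \<open>q ^ k = - 1\<close> has \<open>q\<^sup>2\<close> of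
  order dividing \<open>k\<close>; conversely the order of \<open>q\<^sup>2\<close> itself serves as
  \<open>k\<close>. If \<open>r\<close> divides \<open>q\<close>, both orders are 0 by convention
  and both sides fail.\<close>

lemma odd_power_cong_minus_1_iff_ord:
  fixes q r :: nat
  assumes r: "prime r" "odd r"
  shows "(\<exists>k. odd k \<and> [int q ^ k = - 1] (mod int r)) \<longleftrightarrow> even (ord r q) \<and> odd (ord r (q\<^sup>2))"
proof
  assume "\<exists>k. odd k \<and> [int q ^ k = - 1] (mod int r)"
  then obtain k where k: "odd k" "[int q ^ k = - 1] (mod int r)"
    by blast
  from cong_pow[OF k(2), of 2] have "[(q\<^sup>2) ^ k = 1] (mod r)"
    by (simp add: mult.commute flip: cong_int_iff power_mult)
  then have "ord r (q\<^sup>2) dvd k"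
    by (simp only: ord_divides)
  then have "odd (ord r (q\<^sup>2))"
    using k(1) dvd_trans by blast
  moreover have "even (ord r q)"
  proof (rule ccontr)
    assume odd: "odd (ord r q)"
    \<comment> \<open>This power is -1 because the order is assumed odd, and 1 because the exponent
      is a multiple of the order; an odd \<open>r\<close> forbids both.\<close>
    have "[int q ^ (k * ord r q) = (- 1) ^ ord r q] (mod int r)"
      using cong_pow[OF k(2)] by (simp add: power_mult)
    then have "[int q ^ (k * ord r q) = - 1] (mod int r)"
      using odd by simp
    moreover have "[q ^ (k * ord r q) = 1] (mod r)"
      by (simp only: ord_divides dvd_triv_right)
    then have "[int q ^ (k * ord r q) = 1] (mod int r)"
      by (simp flip: cong_int_iff)
    ultimately have "[1 = - 1] (mod int r)"
      using cong_sym cong_trans by blast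
    then have "int r dvd 2"
      by (simp add: cong_iff_dvd_diff)
    then have "r dvd 2"
      by presburger
    then show False
      using r primes_dvd_imp_eq two_is_prime_nat by blast
  qed
  ultimately show "even (ord r q) \<and> odd (ord r (q\<^sup>2))"
    by blast
next
  assume ord: "even (ord r q) \<and> odd (ord r (q\<^sup>2))"
  define m where "m = ord r (q\<^sup>2)"
  have "[(q\<^sup>2) ^ m = 1] (mod r)"
    by (simp only: m_def ord_divides dvd_refl)
  then have "[(int q ^ m)\<^sup>2 = 1] (mod int r)"
    by (simp add: mult.commute flip: cong_int_iff power_mult)
  then have "int r dvd (int q ^ m - 1) * (int q ^ m + 1)"
    by (simp add: cong_iff_dvd_diff power2_eq_square algebra_simps)
  \<comment> \<open>Modulo a prime, \<open>q ^ m\<close> is a square root of 1, hence 1 or -1. The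
    value 1 would make the even order of \<open>q\<close> divide the odd \<open>m\<close>.\<close>
  then consider "int r dvd int q ^ m - 1" | "int r dvd int q ^ m + 1"
    using r(1) prime_dvd_mult_iff[of "int r"] by auto
  then show "\<exists>k. odd k \<and> [int q ^ k = - 1] (mod int r)"
  proof cases
    case 1
    then have "[q ^ m = 1] (mod r)"
      by (simp add: cong_iff_dvd_diff flip: cong_int_iff)
    then have "ord r q dvd m"
      by (simp only: ord_divides)
    then show ?thesis
      using ord dvd_trans unfolding m_def by blast
  next
    case 2
    then show ?thesis
      using ord unfolding m_def by (auto simp: cong_iff_dvd_diff)
  qed
qed

theorem theorem5p7:
  fixes q n :: nat
  assumes "primepow q" and "n > 0" and "odd n" and "coprime n q"
  shows "gives_splitting ((int q)\<^sup>2) (int n) (- int q) \<longleftrightarrow>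
    (\<forall>r::nat. prime r \<and> r dvd n \<longrightarrow> odd (ord r q) \<or> even (ord r (q\<^sup>2)))"
proof -
  have "gives_splitting ((int q)\<^sup>2) (int n) (- int q) \<longleftrightarrow>
    (\<forall>r. prime r \<and> r dvd int n \<longrightarrow> (\<forall>k. odd k \<longrightarrow> \<not> [(- int q) ^ k = 1] (mod r)))"
    using gives_splitting_iff_no_odd_power_cong_1[of "int n" "- int q"] assms
    by (simp add: coprime_commute)
  also have "\<dots> \<longleftrightarrow>
    (\<forall>r::nat. prime r \<and> r dvd n \<longrightarrow> (\<forall>k. odd k \<longrightarrow> \<not> [(- int q) ^ k = 1] (mod int r)))"
  proof -
    \<comment> \<open>Integer primes are nonnegative by definition, so they are the images of the
      natural ones.\<close>
    have *: "prime r \<and> r dvd int n \<longleftrightarrow> (\<exists>p::nat. r = int p \<and> prime p \<and> p dvd n)" for r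
      using prime_ge_0_int[of r] by (cases r rule: int_cases2) auto
    show ?thesis
      unfolding * by blast
  qed
  also have "\<dots> \<longleftrightarrow>
    (\<forall>r::nat. prime r \<and> r dvd n \<longrightarrow> \<not> (\<exists>k. odd k \<and> [int q ^ k = - 1] (mod int r)))"
  proof -
    have "[(- int q) ^ k = 1] (mod m) \<longleftrightarrow> [int q ^ k = - 1] (mod m)" if "odd k" for k m
      using that cong_minus_minus_iff[of "int q ^ k" "- 1" m] by simp
    then show ?thesis
      by blast
  qed
  also have "\<dots> \<longleftrightarrow> (\<forall>r::nat. prime r \<and> r dvd n \<longrightarrow> odd (ord r q) \<or> even (ord r (q\<^sup>2)))"
  proof -
    \<comment> \<open>Oddness of \<open>n\<close> enters here: it keeps 1 and -1 distinct modulo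
      each prime divisor.\<close>
    have "odd r" if "r dvd n" for r
      using that \<open>odd n\<close> dvd_trans by blast
    then show ?thesis
      using odd_power_cong_minus_1_iff_ord by blast
  qed
  finally show ?thesis .
qed

end
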